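(* Let $n \ge 1$ be an integer, let $x,y \in [0,\infty)^n$, and fix an integer $r \geq 1$. If $$F_{k,r}(x) \leq F_{k,r}(y)$$ for all integers $k$ in the interval $r \leq k \leq nr$, then $$\|x\|_p \leq \|y\|_p \quad \text{for every real } p \text{ with } 0 \leq p \leq 1.$$ If also $\sum_{i=1}^n x_i = \sum_{i=1}^n y_i$, then $$\|x\|_p \geq \|y\|_p \quad \text{for every real } p \text{ with } 1 \leq p \leq r+1.$$
   Context: Notation. For $x=(x_1,\dots,x_n) \in \mathbb{R}^n$ the $l^p$ means are normalized: for real $p > 0$, $\|x\|_p := \left(\frac{1}{n}\sum_{i=1}^n |x_i|^p\right)^{1/p}$, and for $p=0$, $\|x\|_0 := \left(\prod_{i=1}^n |x_i|\right)^{1/n}$ (the geometric mean). For integers $r \ge 1$ and $k \geq 1$, $F_{k,r}(x)$ denotes the coefficient of $t^k$ in the polynomial in $t$ $$f_r(x,t) := \prod_{i=1}^n \left(1 + x_i t + \frac{(x_it)^2}{2!} + \dots + \frac{(x_i t)^r}{r!}\right).$$ Equivalently, $$F_{k,r}(x_1,\dots,x_n) = \sum_{(k_1,\dots,k_n)} \ \prod_{i=1}^n \frac{x_i^{k_i}}{k_i!},$$ where the sum is over all $n$-tuples of nonnegative integers $(k_1,\dots,k_n)$ with $\sum_{i=1}^n k_i = k$ and $\max_i k_i \leq r$ (with the convention $x_i^0=1$). *)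

theory Defs
  imports "HOL-Analysis.Analysis" "HOL-Computational_Algebra.Polynomial"
begin

text \<open>
  The dimension \<open>n\<close> is \<open>CARD('n)\<close>, which is at least 1 for every finite type.
\<close>

text \<open>
  The means are normalized by \<open>1 / n\<close>. Only exponents \<open>p \<ge> 0\<close> are meaningful here;
  for \<open>p > 0\<close> the convention \<open>0 powr p = 0\<close> agrees with the usual \<open>0\<^sup>p = 0\<close>.
\<close>

definition lp_mean :: "real \<Rightarrow> real ^ 'n \<Rightarrow> real" where
  "lp_mean p x =
     (if p = 0 then root CARD('n) (\<Prod>i\<in>UNIV. \<bar>x $ i\<bar>)
      else (1 / real CARD('n) * (\<Sum>i\<in>UNIV. \<bar>x $ i\<bar> powr p)) powr (1 / p))"

definition trunc_exp_prod :: "nat \<Rightarrow> real ^ 'n \<Rightarrow> real poly" where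
  "trunc_exp_prod r x = (\<Prod>i\<in>UNIV. \<Sum>j\<le>r. monom ((x $ i) ^ j / fact j) j)"

lemma poly_trunc_exp_prod:
  "poly (trunc_exp_prod r x) t = (\<Prod>i\<in>UNIV. \<Sum>j\<le>r. (x $ i * t) ^ j / fact j)"
  by (simp add: trunc_exp_prod_def poly_prod poly_sum poly_monom power_mult_distrib)

definition trunc_exp_coeff :: "nat \<Rightarrow> nat \<Rightarrow> real ^ 'n \<Rightarrow> real" where
  "trunc_exp_coeff k r x = coeff (trunc_exp_prod r x) k"

end

theory Submission
  imports Defs
begin

text \<open>
  Write \<open>e\<^sub>r(s) = \<Sum>j\<le>r. s ^ j / fact j\<close>, so that the generating polynomial of the hypotheses is
  \<open>f(x, t) = \<Prod>i. e\<^sub>r(x\<^sub>i t)\<close>. The assumed inequalities between coefficients extend to all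
  coefficients: up to degree \<open>r\<close> the truncation is invisible and the coefficient is that of
  \<open>exp (S t)\<close> with \<open>S = \<Sum>i. x\<^sub>i\<close> (lemma \<open>coeff_prod_trunc_exp_poly_low\<close>), so the inequality in
  degree \<open>r\<close> alone gives \<open>S\<close> for \<open>x\<close> at most \<open>S\<close> for \<open>y\<close> and with it all lower degrees; beyond
  degree \<open>n r\<close> both polynomials vanish. Hence \<open>f(x, t) \<le> f(y, t)\<close> for every \<open>t \<ge> 0\<close>, that is,
  \<open>\<Sum>i. ln e\<^sub>r(x\<^sub>i t) \<le> \<Sum>i. ln e\<^sub>r(y\<^sub>i t)\<close>.

  Such a family of inequalities is turned into one between power sums by integrating against
  \<open>t powr (- p - 1)\<close>. For any kernel \<open>g\<close> with \<open>g 0 = 0\<close>, the substitution \<open>s = a t\<close> gives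
  \<open>\<integral> g(a t) t powr (- p - 1) dt = C * a powr p\<close> with \<open>C = \<integral> g(s) s powr (- p - 1) ds\<close>, and the
  common factor \<open>C\<close> cancels if it is positive and finite (lemma \<open>sum_powr_le_if_kernel_sums_le\<close>).
  Finiteness of \<open>C\<close> decides the range of \<open>p\<close>:

  \<^item> \<open>g(s) = ln e\<^sub>r(s)\<close> behaves like \<open>s\<close> near 0 and like \<open>r ln s\<close> near infinity, so \<open>0 < p < 1\<close>.
  \<^item> \<open>g(s) = s - ln e\<^sub>r(s)\<close> behaves like \<open>s ^ (r + 1) / fact (r + 1)\<close> near 0 and like \<open>s\<close> near
    infinity, so \<open>1 < p < r + 1\<close>. The minus sign reverses the inequality, and the extra linear
    term cancels when \<open>x\<close> and \<open>y\<close> have the same sum.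

  The remaining exponents are boundary cases: for \<open>p = 0\<close> the top coefficient is, up to a constant, a power of the
  product of the entries, \<open>p = 1\<close> is the inequality between the sums, and in the second part both
  end points of the interval follow by continuity of \<open>a powr p\<close> in \<open>p\<close>.
\<close>

section \<open>Power sums from kernels by a Mellin transform\<close>

text \<open>
  This is the Mellin transform of \<open>g\<close> at \<open>- p\<close>. With values in \<^typ>\<open>ennreal\<close> it exists for every
  nonnegative \<open>g\<close>, and convergence becomes a separate question about finiteness.
\<close>

definition mellin_weighted :: "real \<Rightarrow> (real \<Rightarrow> real) \<Rightarrow> ennreal" where
  "mellin_weighted p g = (\<integral>\<^sup>+ s. ennreal (g s * s powr (- p - 1)) * indicator {0<..} s \<partial>lborel)"

text \<open>
  Substitution \<open>s = x t\<close>; the case \<open>x = 0\<close> relies on \<open>g 0 = 0\<close> and \<open>0 powr p = 0\<close>.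
\<close>

lemma mellin_weighted_scale:
  fixes x p :: real
  assumes g: "g \<in> borel_measurable borel" and g0: "g 0 = 0" and x: "0 \<le> x"
  shows "mellin_weighted p (\<lambda>t. g (x * t)) = ennreal (x powr p) * mellin_weighted p g"
proof (cases "x = 0")
  case True
  then show ?thesis by (simp add: mellin_weighted_def g0)
next
  case False
  with x have x: "0 < x" by simp
  note [measurable] = g
  define h where "h s = ennreal (g s * s powr (- p - 1)) * indicator {0<..} s" for s
  have h_meas[measurable]: "h \<in> borel_measurable borel" unfolding h_def by measurable
  have "ennreal (g (x * t) * t powr (- p - 1)) * indicator {0<..} t
          = ennreal (x powr (p + 1)) * h (0 + x * t)" for t
  proof (cases "0 < t")
    case True
    have "x powr (p + 1) * (x * t) powr (- p - 1) = t powr (- p - 1)"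
      using x True by (simp add: powr_mult flip: powr_add mult.assoc)
    then have "g (x * t) * t powr (- p - 1)
        = x powr (p + 1) * (g (x * t) * (x * t) powr (- p - 1))"
      by (simp only: mult_ac)
    then have "ennreal (g (x * t) * t powr (- p - 1))
        = ennreal (x powr (p + 1)) * ennreal (g (x * t) * (x * t) powr (- p - 1))"
      by (simp only: ennreal_mult' powr_ge_zero)
    then show ?thesis using x True by (simp add: h_def)
  next
    case False
    then show ?thesis using x by (simp add: h_def zero_less_mult_iff)
  qed
  then have "mellin_weighted p (\<lambda>t. g (x * t))
      = (\<integral>\<^sup>+ t. ennreal (x powr (p + 1)) * h (0 + x * t) \<partial>lborel)"
    by (simp add: mellin_weighted_def)
  also have "\<dots> = ennreal (x powr (p + 1)) * (\<integral>\<^sup>+ t. h (0 + x * t) \<partial>lborel)"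
    by (rule nn_integral_cmult) measurable
  also have "ennreal (x powr (p + 1)) = ennreal (x powr p) * ennreal \<bar>x\<bar>"
    using x by (simp add: powr_add ennreal_mult'')
  also have "\<dots> * (\<integral>\<^sup>+ t. h (0 + x * t) \<partial>lborel) = ennreal (x powr p) * integral\<^sup>N lborel h"
    using nn_integral_real_affine[OF h_meas, of x 0] x by (simp add: mult.assoc)
  finally show ?thesis unfolding mellin_weighted_def h_def[abs_def] .
qed

lemma mellin_weighted_pos:
  assumes [measurable]: "g \<in> borel_measurable borel" and pos: "\<And>s. 0 < s \<Longrightarrow> 0 < g s"
  shows "0 < mellin_weighted p g"
proof (rule ccontr)
  assume "\<not> ?thesis"
  then have "mellin_weighted p g = 0" by simp
  then have "AE s in lborel. ennreal (g s * s powr (- p - 1)) * indicator {0<..} s = 0"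
    unfolding mellin_weighted_def by (subst (asm) nn_integral_0_iff_AE) auto
  \<comment> \<open>A positive integrand cannot vanish almost everywhere; any set of positive measure would do.\<close>
  then have "AE s in lborel. s \<notin> {1..2::real}"
  proof eventually_elim
    fix s :: real
    assume *: "ennreal (g s * s powr (- p - 1)) * indicator {0<..} s = 0"
    show "s \<notin> {1..2}"
    proof
      assume "s \<in> {1..2}"
      then have "0 < g s * s powr (- p - 1)" "0 < s" using pos[of s] by simp_all
      with * show False by (simp add: ennreal_eq_0_iff)
    qed
  qed
  then have "emeasure lborel {s \<in> space lborel. \<not> s \<notin> {1..2::real}} = 0"
    by (subst (asm) AE_iff_measurable[OF _ refl]) auto
  moreover have "{s \<in> space lborel. \<not> s \<notin> {1..2::real}} = {1..2}" by auto
  ultimately show False by simp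
qed

lemma nn_integral_powr_atLeast_1_finite:
  fixes e :: real
  assumes "e < - 1"
  shows "(\<integral>\<^sup>+ s. ennreal (s powr e) * indicator {1..} s \<partial>lborel) < \<infinity>"
proof -
  have "(\<integral>\<^sup>+ s. ennreal (s powr e) * indicator {1..} s \<partial>lborel)
      = ennreal (0 - 1 powr (e + 1) / (e + 1))"
  proof (rule nn_integral_FTC_atLeast[where F = "\<lambda>s. s powr (e + 1) / (e + 1)"])
    show "DERIV (\<lambda>s. s powr (e + 1) / (e + 1)) s :> s powr e" if "1 \<le> s" for s
      using that assms by (auto intro!: derivative_eq_intros)
    show "((\<lambda>s. s powr (e + 1) / (e + 1)) \<longlongrightarrow> 0) at_top"
      using assms by (auto intro!: tendsto_divide_zero tendsto_neg_powr filterlim_ident)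
  qed auto
  then show ?thesis by simp
qed

lemma nn_integral_powr_0_1_finite:
  fixes e :: real
  assumes "- 1 < e"
  shows "(\<integral>\<^sup>+ s. ennreal (s powr e) * indicator {0<..1} s \<partial>lborel) < \<infinity>"
proof -
  have "(\<lambda>s. s powr e) integrable_on {0<..1}"
    using assms by (rule integrable_on_powr_from_0') simp
  then obtain I where "((\<lambda>s. s powr e) has_integral I) {0<..1}" by blast
  from nn_integral_has_integral_lebesgue'[OF _ this] show ?thesis by simp
qed

text \<open>
  A growth exponent above \<open>p\<close> at 0 and one below \<open>p\<close> at infinity make both ends of the integral
  converge.
\<close>

lemma mellin_weighted_finite:
  fixes a b p K :: real
  assumes K: "0 \<le> K" and "b < p" "p < a"
    and small: "\<And>s. 0 < s \<Longrightarrow> s \<le> 1 \<Longrightarrow> g s \<le> K * s powr a"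
    and large: "\<And>s. 1 \<le> s \<Longrightarrow> g s \<le> K * s powr b"
  shows "mellin_weighted p g < \<infinity>"
proof -
  have "mellin_weighted p g \<le>
     (\<integral>\<^sup>+ s. ennreal K * (ennreal (s powr (a - p - 1)) * indicator {0<..1} s)
         + ennreal K * (ennreal (s powr (b - p - 1)) * indicator {1..} s) \<partial>lborel)"
    unfolding mellin_weighted_def
  proof (rule nn_integral_mono)
    fix s :: real
    have *: "ennreal (g s * s powr (- p - 1)) \<le> ennreal K * ennreal (s powr (c - p - 1))"
      if "g s \<le> K * s powr c" for c
    proof -
      have "g s * s powr (- p - 1) \<le> K * s powr c * s powr (- p - 1)"
        using that by (rule mult_right_mono) simp
      also have "\<dots> = K * (s powr c * s powr (- p - 1))"
        by (rule mult.assoc)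
      also have "s powr c * s powr (- p - 1) = s powr (c - p - 1)"
        by (subst powr_add[symmetric]) (simp add: algebra_simps)
      finally show ?thesis using K by (simp flip: ennreal_mult add: ennreal_leI)
    qed
    consider "s \<le> 0" | "0 < s" "s < 1" | "s = 1" | "1 < s" by linarith
    then show "ennreal (g s * s powr (- p - 1)) * indicator {0<..} s
        \<le> ennreal K * (ennreal (s powr (a - p - 1)) * indicator {0<..1} s)
         + ennreal K * (ennreal (s powr (b - p - 1)) * indicator {1..} s)"
    proof cases
      case 2 then show ?thesis using *[OF small] by simp
    next
      case 3 then show ?thesis using *[OF small] by (auto intro: order_trans add_increasing2)
    next
      case 4 then show ?thesis using *[OF large] by simp
    qed simp
  qed
  also have "\<dots> = ennreal K * (\<integral>\<^sup>+ s. ennreal (s powr (a - p - 1)) * indicator {0<..1} s \<partial>lborel)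
      + ennreal K * (\<integral>\<^sup>+ s. ennreal (s powr (b - p - 1)) * indicator {1..} s \<partial>lborel)"
    by (simp add: nn_integral_add nn_integral_cmult)
  also have "\<dots> < \<infinity>"
    using nn_integral_powr_0_1_finite[of "a - p - 1"] nn_integral_powr_atLeast_1_finite[of "b - p - 1"]
      assms by (simp add: ennreal_mult_less_top)
  finally show ?thesis .
qed

text \<open>
  Integrating the kernel inequality over \<open>t\<close> multiplies both power sums by the same positive finite
  constant \<open>mellin_weighted p g\<close>, which can be cancelled.
\<close>

lemma sum_powr_le_if_kernel_sums_le:
  fixes u v :: "'a \<Rightarrow> real" and a b p K :: real
  assumes g[measurable]: "g \<in> borel_measurable borel"
    and g0: "g 0 = 0" and pos: "\<And>s. 0 < s \<Longrightarrow> 0 < g s"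
    and K: "0 \<le> K" and "b < p" "p < a"
    and small: "\<And>s. 0 < s \<Longrightarrow> s \<le> 1 \<Longrightarrow> g s \<le> K * s powr a"
    and large: "\<And>s. 1 \<le> s \<Longrightarrow> g s \<le> K * s powr b"
    and u: "\<And>i. i \<in> A \<Longrightarrow> 0 \<le> u i" and v: "\<And>i. i \<in> A \<Longrightarrow> 0 \<le> v i"
    and le: "\<And>t. 0 < t \<Longrightarrow> (\<Sum>i\<in>A. g (u i * t)) \<le> (\<Sum>i\<in>A. g (v i * t))"
  shows "(\<Sum>i\<in>A. u i powr p) \<le> (\<Sum>i\<in>A. v i powr p)"
proof -
  have g_nonneg: "0 \<le> g s" if "0 \<le> s" for s
    using that pos[of s] g0 by (cases "s = 0") auto
  have *: "mellin_weighted p (\<lambda>t. \<Sum>i\<in>A. g (w i * t))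
      = ennreal (\<Sum>i\<in>A. w i powr p) * mellin_weighted p g"
    if w: "\<And>i. i \<in> A \<Longrightarrow> 0 \<le> w i" for w :: "'a \<Rightarrow> real"
  proof -
    have "ennreal ((\<Sum>i\<in>A. g (w i * t)) * t powr (- p - 1)) * indicator {0<..} t
        = (\<Sum>i\<in>A. ennreal (g (w i * t) * t powr (- p - 1)) * indicator {0<..} t)" for t
      using w g_nonneg
      by (cases "0 < t") (auto simp: sum_distrib_right intro!: sum_ennreal[symmetric])
    then have "mellin_weighted p (\<lambda>t. \<Sum>i\<in>A. g (w i * t))
       = (\<Sum>i\<in>A. mellin_weighted p (\<lambda>t. g (w i * t)))"
      by (simp add: mellin_weighted_def nn_integral_sum)
    also have "\<dots> = (\<Sum>i\<in>A. ennreal (w i powr p) * mellin_weighted p g)"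
      using w by (intro sum.cong refl mellin_weighted_scale g g0)
    also have "\<dots> = ennreal (\<Sum>i\<in>A. w i powr p) * mellin_weighted p g"
      by (simp add: sum_distrib_right[symmetric])
    finally show ?thesis .
  qed
  have "mellin_weighted p (\<lambda>t. \<Sum>i\<in>A. g (u i * t)) \<le> mellin_weighted p (\<lambda>t. \<Sum>i\<in>A. g (v i * t))"
    unfolding mellin_weighted_def
    by (intro nn_integral_mono) (auto simp: indicator_def intro!: ennreal_leI mult_right_mono le)
  then have "ennreal (\<Sum>i\<in>A. u i powr p) * mellin_weighted p g
      \<le> ennreal (\<Sum>i\<in>A. v i powr p) * mellin_weighted p g"
    using *[of u] *[of v] u v by simp
  moreover have "mellin_weighted p g \<noteq> 0"
    using mellin_weighted_pos[OF g pos, of p] by simp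
  moreover have "mellin_weighted p g \<noteq> \<infinity>"
    using mellin_weighted_finite[OF K \<open>b < p\<close> \<open>p < a\<close> small large] by simp
  ultimately have "ennreal (\<Sum>i\<in>A. u i powr p) \<le> ennreal (\<Sum>i\<in>A. v i powr p)"
    by (simp add: mult.commute[of _ "mellin_weighted p g"] ennreal_mult_le_mult_iff)
  then show ?thesis by (simp add: sum_nonneg)
qed

section \<open>The two kernels built from the truncated exponential\<close>

definition trunc_exp :: "nat \<Rightarrow> real \<Rightarrow> real" where
  "trunc_exp r s = (\<Sum>j\<le>r. s ^ j / fact j)"

lemma trunc_exp_measurable[measurable]: "trunc_exp r \<in> borel_measurable borel"
  unfolding trunc_exp_def by measurable

lemma trunc_exp_0 [simp]: "trunc_exp r 0 = 1"
  by (simp add: trunc_exp_def power_0_left if_distrib[of "\<lambda>z. z / _"] cong: if_cong)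

lemma trunc_exp_ge_1_plus:
  assumes "1 \<le> r" "0 \<le> s"
  shows "1 + s \<le> trunc_exp r s"
proof -
  have "(\<Sum>j\<le>1. s ^ j / fact j) \<le> trunc_exp r s"
    unfolding trunc_exp_def using assms by (intro sum_mono2) auto
  then show ?thesis by simp
qed

text \<open>
  Both bounds come from the Lagrange form of the remainder. The strict one makes
  \<open>s - ln (trunc_exp r s)\<close> positive; the crude upper one already has the exponent \<open>r + 1\<close> that
  determines the range of \<open>p\<close>.
\<close>

lemma exp_trunc_exp_remainder:
  assumes "0 < s"
  shows "trunc_exp r s < exp s" "exp s - trunc_exp r s \<le> exp s * s ^ (r + 1)"
proof -
  obtain t where t: "\<bar>t\<bar> \<le> \<bar>s\<bar>"
      "exp s = (\<Sum>m<Suc r. s ^ m / fact m) + exp t / fact (Suc r) * s ^ Suc r"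
    using Maclaurin_exp_le by blast
  then have eq: "exp s - trunc_exp r s = exp t / fact (Suc r) * s ^ Suc r"
    by (simp add: trunc_exp_def lessThan_Suc_atMost)
  show "trunc_exp r s < exp s"
  proof -
    have "0 < exp t / fact (Suc r) * s ^ Suc r"
      using assms by (intro mult_pos_pos divide_pos_pos zero_less_power) auto
    with eq show ?thesis by linarith
  qed
  have "exp t / fact (Suc r) \<le> exp s / 1"
  proof (rule frac_le)
    show "exp t \<le> exp s" using t(1) assms by simp
  qed (simp_all only: exp_ge_zero fact_ge_1 zero_less_one)
  then show "exp s - trunc_exp r s \<le> exp s * s ^ (r + 1)"
    unfolding eq using assms by (intro mult_mono) (simp_all del: fact_Suc)
qed

lemma trunc_exp_le_exp: "0 \<le> s \<Longrightarrow> trunc_exp r s \<le> exp s"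
  using exp_trunc_exp_remainder(1)[of s r] by (cases "s = 0") auto

lemma trunc_exp_le_power:
  assumes "1 \<le> s"
  shows "trunc_exp r s \<le> exp 1 * s ^ r"
proof -
  have "trunc_exp r s \<le> (\<Sum>j\<le>r. 1 ^ j / fact j * s ^ r)"
    unfolding trunc_exp_def using assms
    by (intro sum_mono) (auto simp: divide_simps intro: power_increasing)
  also have "\<dots> = trunc_exp r 1 * s ^ r"
    by (simp add: trunc_exp_def sum_distrib_right)
  also have "\<dots> \<le> exp 1 * s ^ r"
    using assms trunc_exp_le_exp[of 1 r] by (intro mult_right_mono) auto
  finally show ?thesis .
qed

text \<open>
  The kernel \<open>ln (trunc_exp r s)\<close> is at most \<open>s\<close>, and for \<open>s \<ge> 1\<close> at most \<open>1 + r ln s\<close>. Any power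
  with an exponent strictly between 0 and \<open>p\<close> dominates the logarithm; \<open>p / 2\<close> is chosen.
\<close>

lemma sum_powr_le_if_sum_ln_trunc_exp_le:
  fixes u v :: "'a \<Rightarrow> real" and p :: real
  assumes r: "1 \<le> r" and p: "0 < p" "p < 1"
    and u: "\<And>i. i \<in> A \<Longrightarrow> 0 \<le> u i" and v: "\<And>i. i \<in> A \<Longrightarrow> 0 \<le> v i"
    and le: "\<And>t. 0 < t \<Longrightarrow>
      (\<Sum>i\<in>A. ln (trunc_exp r (u i * t))) \<le> (\<Sum>i\<in>A. ln (trunc_exp r (v i * t)))"
  shows "(\<Sum>i\<in>A. u i powr p) \<le> (\<Sum>i\<in>A. v i powr p)"
proof (rule sum_powr_le_if_kernel_sums_le
    [where g = "\<lambda>s. ln (trunc_exp r s)" and a = 1 and b = "p / 2" and K = "1 + real r / (p / 2)"])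
  have gt1: "1 < trunc_exp r s" if "0 < s" for s
    using trunc_exp_ge_1_plus[OF r, of s] that by simp
  then show "0 < ln (trunc_exp r s)" if "0 < s" for s using gt1[OF that] by simp
  show "ln (trunc_exp r s) \<le> (1 + real r / (p / 2)) * s powr 1" if "0 < s" "s \<le> 1" for s
  proof -
    have "ln (trunc_exp r s) \<le> s"
      using trunc_exp_le_exp[of s r] gt1[of s] that
        ln_mono[of "trunc_exp r s" "exp s"] by simp
    moreover have "0 \<le> real r / (p / 2) * s" using p that by simp
    ultimately show ?thesis using that by (simp add: distrib_right)
  qed
  show "ln (trunc_exp r s) \<le> (1 + real r / (p / 2)) * s powr (p / 2)" if s: "1 \<le> s" for s
  proof -
    have "ln (trunc_exp r s) \<le> ln (exp 1 * s ^ r)"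
      using trunc_exp_le_power[OF s, of r] gt1[of s] s by simp
    also have "\<dots> = 1 + real r * ln s" using s by (simp add: ln_mult ln_realpow)
    also have "\<dots> \<le> s powr (p / 2) + real r * (s powr (p / 2) / (p / 2))"
      using s p ln_powr_bound[OF s, of "p / 2"]
      by (intro add_mono mult_left_mono) (auto simp: ge_one_powr_ge_zero)
    finally show ?thesis by (simp add: algebra_simps)
  qed
qed (use assms in auto)

text \<open>
  Subtracting the linear term of \<open>ln (trunc_exp r s)\<close> at 0 kills all terms of order at most \<open>r\<close>,
  because \<open>trunc_exp r s\<close> agrees with \<open>exp s\<close> to that order. So \<open>s - ln (trunc_exp r s)\<close> is
  \<open>O(s ^ (r + 1))\<close> at 0, and it is at most \<open>s\<close> everywhere.
\<close>

lemma sum_powr_ge_if_sum_ln_trunc_exp_le: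
  fixes u v :: "'a \<Rightarrow> real" and p :: real
  assumes r: "1 \<le> r" and p: "1 < p" "p < real r + 1"
    and u: "\<And>i. i \<in> A \<Longrightarrow> 0 \<le> u i" and v: "\<And>i. i \<in> A \<Longrightarrow> 0 \<le> v i"
    and sum_eq: "(\<Sum>i\<in>A. u i) = (\<Sum>i\<in>A. v i)"
    and le: "\<And>t. 0 < t \<Longrightarrow>
      (\<Sum>i\<in>A. ln (trunc_exp r (u i * t))) \<le> (\<Sum>i\<in>A. ln (trunc_exp r (v i * t)))"
  shows "(\<Sum>i\<in>A. v i powr p) \<le> (\<Sum>i\<in>A. u i powr p)"
proof (rule sum_powr_le_if_kernel_sums_le
    [where g = "\<lambda>s. s - ln (trunc_exp r s)" and a = "real r + 1" and b = 1 and K = "exp 1"])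
  have ge1: "1 \<le> trunc_exp r s" if "0 \<le> s" for s
    using trunc_exp_ge_1_plus[OF r, of s] that by simp
  show "0 < s - ln (trunc_exp r s)" if "0 < s" for s
  proof -
    have "ln (trunc_exp r s) < ln (exp s)"
      using exp_trunc_exp_remainder(1)[OF that, of r] ge1[of s] that
      by (subst ln_less_cancel_iff) auto
    then show ?thesis by simp
  qed
  show "s - ln (trunc_exp r s) \<le> exp 1 * s powr (real r + 1)" if s: "0 < s" "s \<le> 1" for s
  proof -
    have E: "1 \<le> trunc_exp r s" using ge1 s by simp
    \<comment> \<open>Since \<open>ln z \<le> z - 1\<close>, the kernel is bounded by the relative Taylor remainder of \<open>exp\<close>.\<close>
    have "s - ln (trunc_exp r s) = ln (exp s / trunc_exp r s)"
      using E by (simp add: ln_div)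
    also have "\<dots> \<le> exp s / trunc_exp r s - 1"
      using E by (intro ln_le_minus_one) simp
    also have "\<dots> = (exp s - trunc_exp r s) / trunc_exp r s" using E by (simp add: diff_divide_distrib)
    also have "\<dots> \<le> (exp s - trunc_exp r s) / 1"
      using E trunc_exp_le_exp[of s r] s by (intro divide_left_mono) auto
    also have "\<dots> \<le> exp s * s ^ (r + 1)" using exp_trunc_exp_remainder(2)[of s r] s by simp
    also have "\<dots> \<le> exp 1 * s ^ (r + 1)" using s by (intro mult_right_mono) auto
    also have "s ^ (r + 1) = s powr (real r + 1)"
      using s powr_realpow[of s "r + 1"] by (simp add: add.commute)
    finally show ?thesis .
  qed
  show "s - ln (trunc_exp r s) \<le> exp 1 * s powr 1" if "1 \<le> s" for s
  proof -
    have "s - ln (trunc_exp r s) \<le> 1 * s" using ge1[of s] that by simp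
    also have "\<dots> \<le> exp 1 * s" using that by (intro mult_right_mono) auto
    finally show ?thesis using that by simp
  qed
  show "(\<Sum>i\<in>A. v i * t - ln (trunc_exp r (v i * t))) \<le> (\<Sum>i\<in>A. u i * t - ln (trunc_exp r (u i * t)))"
    if "0 < t" for t
    using le[OF that] sum_eq by (simp add: sum_subtractf flip: sum_distrib_right)
qed (use assms in auto)

section \<open>Coefficients of the generating polynomial\<close>

definition trunc_exp_poly :: "nat \<Rightarrow> real \<Rightarrow> real poly" where
  "trunc_exp_poly r a = (\<Sum>j\<le>r. monom (a ^ j / fact j) j)"

lemma coeff_trunc_exp_poly:
  "coeff (trunc_exp_poly r a) k = (if k \<le> r then a ^ k / fact k else 0)"
  by (simp add: trunc_exp_poly_def coeff_sum)

lemma degree_trunc_exp_poly: "degree (trunc_exp_poly r a) \<le> r"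
  by (rule degree_le) (simp add: coeff_trunc_exp_poly)

text \<open>
  In degrees up to \<open>r\<close> each factor has the coefficients of \<open>exp (u i * t)\<close>, so the product has those
  of \<open>exp ((\<Sum>i\<in>A. u i) * t)\<close>; the induction step is the binomial theorem.
\<close>

lemma coeff_prod_trunc_exp_poly_low:
  assumes "finite A" "k \<le> r"
  shows "coeff (\<Prod>i\<in>A. trunc_exp_poly r (u i)) k = (\<Sum>i\<in>A. u i) ^ k / fact k"
  using assms
proof (induction A arbitrary: k rule: finite_induct)
  case empty
  then show ?case by (cases k) auto
next
  case (insert a A)
  have "coeff (\<Prod>i\<in>insert a A. trunc_exp_poly r (u i)) k
      = (\<Sum>i\<le>k. u a ^ i / fact i * ((\<Sum>i\<in>A. u i) ^ (k - i) / fact (k - i)))"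
    using insert by (simp add: coeff_mult coeff_trunc_exp_poly)
  also have "\<dots> = (u a + (\<Sum>i\<in>A. u i)) ^ k / fact k"
    using exp_series_add_commuting[of "u a" "\<Sum>i\<in>A. u i" k]
    by (simp add: divide_inverse mult_ac)
  finally show ?case using insert by simp
qed

text \<open>
  Degree bounds instead of exact degrees are needed here, since \<open>trunc_exp_poly r 0\<close> is constant:
  entries of the vectors may vanish.
\<close>

lemma coeff_mult_top:
  fixes p q :: "'a :: comm_semiring_0 poly"
  assumes "degree p \<le> m" "degree q \<le> n"
  shows "coeff (p * q) (m + n) = coeff p m * coeff q n"
proof -
  have "coeff (p * q) (m + n) = (\<Sum>i\<le>m + n. if i = m then coeff p m * coeff q n else 0)"
    unfolding coeff_mult
  proof (intro sum.cong refl)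
    fix i
    show "coeff p i * coeff q (m + n - i) = (if i = m then coeff p m * coeff q n else 0)"
      using assms by (cases i m rule: linorder_cases) (auto simp: coeff_eq_0)
  qed
  then show ?thesis by simp
qed

lemma degree_prod_trunc_exp_poly:
  assumes "finite A"
  shows "degree (\<Prod>i\<in>A. trunc_exp_poly r (u i)) \<le> card A * r"
proof -
  have "degree (\<Prod>i\<in>A. trunc_exp_poly r (u i)) \<le> sum (degree \<circ> (\<lambda>i. trunc_exp_poly r (u i))) A"
    using assms by (rule degree_prod_sum_le)
  also have "\<dots> \<le> card A * r"
    using sum_bounded_above[of A "degree \<circ> (\<lambda>i. trunc_exp_poly r (u i))" r]
    by (simp add: degree_trunc_exp_poly)
  finally show ?thesis .
qed

lemma coeff_prod_trunc_exp_poly_top: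
  assumes "finite A"
  shows "coeff (\<Prod>i\<in>A. trunc_exp_poly r (u i)) (card A * r) = (\<Prod>i\<in>A. u i) ^ r / fact r ^ card A"
  using assms
proof (induction A rule: finite_induct)
  case (insert a A)
  then have "coeff (\<Prod>i\<in>insert a A. trunc_exp_poly r (u i)) (card (insert a A) * r)
      = coeff (trunc_exp_poly r (u a)) r * coeff (\<Prod>i\<in>A. trunc_exp_poly r (u i)) (card A * r)"
    by (simp add: coeff_mult_top degree_trunc_exp_poly degree_prod_trunc_exp_poly)
  with insert show ?case
    by (simp add: coeff_trunc_exp_poly power_mult_distrib)
qed simp

lemma trunc_exp_prod_eq: "trunc_exp_prod r x = (\<Prod>i\<in>UNIV. trunc_exp_poly r (x $ i))"
  by (simp add: trunc_exp_prod_def trunc_exp_poly_def)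

lemma poly_le_if_coeff_le:
  fixes p q :: "'a :: linordered_idom poly"
  assumes "\<And>k. coeff p k \<le> coeff q k" "0 \<le> t"
  shows "poly p t \<le> poly q t"
proof -
  have *: "poly f t = (\<Sum>k\<le>max (degree p) (degree q). coeff f k * t ^ k)"
    if "degree f \<le> max (degree p) (degree q)" for f
    unfolding poly_altdef using that by (intro sum.mono_neutral_left) (auto simp: coeff_eq_0)
  show ?thesis using assms by (subst (1 2) *) (auto intro!: sum_mono mult_right_mono)
qed

section \<open>Comparison of the means\<close>

lemma lp_mean_le_iff_sum_powr:
  fixes x y :: "real ^ 'n"
  assumes "0 < p" "\<And>i. 0 \<le> x $ i" "\<And>i. 0 \<le> y $ i"
  shows "lp_mean p x \<le> lp_mean p y \<longleftrightarrow> (\<Sum>i\<in>UNIV. x $ i powr p) \<le> (\<Sum>i\<in>UNIV. y $ i powr p)"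
proof -
  let ?M = "\<lambda>w :: real ^ 'n. (\<Sum>i\<in>UNIV. w $ i powr p)"
  have M: "lp_mean p w = (?M w / real CARD('n)) powr (1 / p)" if "\<And>i. 0 \<le> w $ i" for w
    using assms that by (simp add: lp_mean_def)
  have nonneg: "0 \<le> ?M w" for w by (simp add: sum_nonneg)
  have "lp_mean p x \<le> lp_mean p y" if "?M x \<le> ?M y"
    using that assms nonneg by (auto simp: M intro!: powr_mono2 divide_right_mono)
  moreover have "lp_mean p y < lp_mean p x" if "?M y < ?M x"
    using that assms nonneg by (auto simp: M intro!: powr_less_mono2 divide_strict_right_mono)
  ultimately show ?thesis by (meson not_le)
qed

theorem theorem1:
  fixes x y :: "real ^ 'n" and r :: nat
  assumes "\<And>i. 0 \<le> x $ i" and "\<And>i. 0 \<le> y $ i"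
    and "1 \<le> r"
    and "\<And>k. r \<le> k \<Longrightarrow> k \<le> CARD('n) * r \<Longrightarrow>
           trunc_exp_coeff k r x \<le> trunc_exp_coeff k r y"
  shows "(\<forall>p::real. 0 \<le> p \<and> p \<le> 1 \<longrightarrow> lp_mean p x \<le> lp_mean p y) \<and>
         ((\<Sum>i\<in>UNIV. x $ i) = (\<Sum>i\<in>UNIV. y $ i) \<longrightarrow>
           (\<forall>p::real. 1 \<le> p \<and> p \<le> real r + 1 \<longrightarrow> lp_mean p x \<ge> lp_mean p y))"
proof -
  note nonneg = assms(1,2) and r = assms(3)
  let ?S = "\<lambda>w :: real ^ 'n. \<Sum>i\<in>UNIV. w $ i"
  have low: "trunc_exp_coeff k r w = ?S w ^ k / fact k" if "k \<le> r" for k and w :: "real ^ 'n"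
    using that by (simp add: trunc_exp_coeff_def trunc_exp_prod_eq coeff_prod_trunc_exp_poly_low)
  have top: "trunc_exp_coeff (CARD('n) * r) r w = (\<Prod>i\<in>UNIV. w $ i) ^ r / fact r ^ CARD('n)"
    for w :: "real ^ 'n"
    by (simp add: trunc_exp_coeff_def trunc_exp_prod_eq coeff_prod_trunc_exp_poly_top)
  have high: "trunc_exp_coeff k r w = 0" if "CARD('n) * r < k" for k and w :: "real ^ 'n"
    unfolding trunc_exp_coeff_def trunc_exp_prod_eq
    using that degree_prod_trunc_exp_poly[of UNIV r "\<lambda>i. w $ i"] by (intro coeff_eq_0) simp
  have S_nonneg: "0 \<le> ?S x" "0 \<le> ?S y" using nonneg by (auto intro: sum_nonneg)
  have S_le: "?S x \<le> ?S y"
  proof -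
    have "trunc_exp_coeff r r x \<le> trunc_exp_coeff r r y" by (rule assms(4)) auto
    then have "?S x ^ r \<le> ?S y ^ r" by (simp add: low divide_le_cancel)
    then show ?thesis using r S_nonneg by (simp add: power_mono_iff)
  qed
  have prod_le: "(\<Prod>i\<in>UNIV. x $ i) \<le> (\<Prod>i\<in>UNIV. y $ i)"
  proof -
    have "trunc_exp_coeff (CARD('n) * r) r x \<le> trunc_exp_coeff (CARD('n) * r) r y"
      by (rule assms(4)) auto
    then have "(\<Prod>i\<in>UNIV. x $ i) ^ r \<le> (\<Prod>i\<in>UNIV. y $ i) ^ r"
      by (simp add: top divide_le_cancel)
    then show ?thesis using r nonneg by (simp add: power_mono_iff prod_nonneg)
  qed
  have coeff_le: "coeff (trunc_exp_prod r x) k \<le> coeff (trunc_exp_prod r y) k" for k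
  proof -
    consider "k \<le> r" | "r \<le> k" "k \<le> CARD('n) * r" | "CARD('n) * r < k" by linarith
    then have "trunc_exp_coeff k r x \<le> trunc_exp_coeff k r y"
      using assms(4) by cases (auto simp: low high divide_right_mono power_mono S_le S_nonneg)
    then show ?thesis by (simp add: trunc_exp_coeff_def)
  qed
  have ln_le: "(\<Sum>i\<in>UNIV. ln (trunc_exp r (x $ i * t))) \<le> (\<Sum>i\<in>UNIV. ln (trunc_exp r (y $ i * t)))"
    if "0 < t" for t
  proof -
    have pos: "0 < trunc_exp r (w $ i * t)" if "\<And>i. 0 \<le> w $ i" for w :: "real ^ 'n" and i
      using trunc_exp_ge_1_plus[OF r, of "w $ i * t"] \<open>0 < t\<close> that[of i]
        mult_nonneg_nonneg[of "w $ i" t] by linarith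
    have "(\<Prod>i\<in>UNIV. trunc_exp r (x $ i * t)) \<le> (\<Prod>i\<in>UNIV. trunc_exp r (y $ i * t))"
      using poly_le_if_coeff_le[OF coeff_le, of t] that
      by (simp add: poly_trunc_exp_prod trunc_exp_def)
    then show ?thesis
      using pos nonneg by (simp flip: ln_prod add: prod_pos less_imp_neq[symmetric])
  qed
  have "lp_mean p x \<le> lp_mean p y" if p: "0 \<le> p" "p \<le> 1" for p
  proof -
    consider "p = 0" | "0 < p" "p < 1" | "p = 1"
      using p by linarith
    then show ?thesis
    proof cases
      case 1
      then show ?thesis using prod_le nonneg by (simp add: lp_mean_def)
    next
      case 2
      then show ?thesis
        using sum_powr_le_if_sum_ln_trunc_exp_le[OF r 2, of UNIV "\<lambda>i. x $ i" "\<lambda>i. y $ i"] nonneg ln_le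
        by (simp add: lp_mean_le_iff_sum_powr)
    next
      case 3
      then show ?thesis using S_le nonneg by (simp add: lp_mean_le_iff_sum_powr)
    qed
  qed
  moreover have "lp_mean p y \<le> lp_mean p x"
    if eq: "?S x = ?S y" and p: "1 \<le> p" "p \<le> real r + 1" for p
  proof -
    let ?D = "\<lambda>p. (\<Sum>i\<in>UNIV. x $ i powr p) - (\<Sum>i\<in>UNIV. y $ i powr p)"
    \<comment> \<open>At \<open>p = r + 1\<close> the integral of the kernel diverges at 0, so this exponent needs a limit.\<close>
    have "0 \<le> ?D p"
    proof (rule continuous_ge_on_Ioo[where g = ?D])
      show "continuous_on {1..real r + 1} ?D"
        using nonneg by (intro continuous_intros continuous_on_powr') auto
      show "0 \<le> ?D q" if "q \<in> {1<..<real r + 1}" for q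
        using sum_powr_ge_if_sum_ln_trunc_exp_le[OF r, of q UNIV "\<lambda>i. x $ i" "\<lambda>i. y $ i"]
          that nonneg ln_le eq by simp
    qed (use r p in auto)
    then show ?thesis using p nonneg by (simp add: lp_mean_le_iff_sum_powr)
  qed
  ultimately show ?thesis by blast
qed

end
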